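(* Consider a college admissions problem with a common strict priority order induced by scores, under complete information, and suppose that the number of rounds satisfies $T\ge |I|$. Then the strategy profile in which every student follows the straightforward strategy is a Nash equilibrium of the game induced by the $T$-round time-constrained dynamic mechanism (TCDM).
   Context: Problem. $I$ is a finite set of students and $C$ a finite set of colleges. Each student $i$ has a strict preference (linear order) $\succ_i$ over $C\cup\{\emptyset\}$, where $\emptyset$ is the outside option (being unassigned). Each college $c$ has capacity $q_c\in\mathbb{N}_+$. Each student has a score $s_i>0$, scores are distinct, and every college uses the common strict priority order $i\triangleright j\iff s_i>s_j$. A matching is a map $\mu:I\to C\cup\{\emptyset\}$ with $|\mu^{-1}(c)|\le q_c$ for all $c$. The cutoff of $c$ at $\mu$ is $f_c(\mu)=\min\{s_i:i\in\mu^{-1}(c)\}$ if $|\mu^{-1}(c)|=q_c$, and $f_c(\mu)=0$ otherwise. Game induced by the $T$-round TCDM. Preferences, scores, capacities and $T$ are common knowledge. In each round $t=1,\dots,T$ all students simultaneously choose an action in $A=C\cup\{\emptyset\}$ (an application, replacing any earlier one), after observing all students' actions in rounds $1,\dots,t-1$. Given the round-$t$ action profile, each college holds its highest-priority round-$t$ applicants up to capacity and rejects the others; this defines the tentative matching $\mu^t$ (students who are rejected or chose $\emptyset$ are unassigned). A pure strategy of student $i$ assigns, for each $t$, an action in $A$ to every possible sequence of action profiles of rounds $1,\dots,t-1$. The final matching is $\mu^T$, and students rank outcomes by their own assignment $\mu^T(i)$ according to $\succ_i$. A strategy profile is a Nash equilibrium if no student has a pure strategy which, holding the other students' strategies fixed,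 yields her a strictly preferred final assignment. Straightforward strategy. In round 1 student $i$ applies to her $\succ_i$-best element of $C\cup\{\emptyset\}$. In round $t>1$, at every history with previous-round tentative matching $\mu^{t-1}$: if $\mu^{t-1}(i)\in C$, she applies to $\mu^{t-1}(i)$; if $\mu^{t-1}(i)=\emptyset$, she chooses her $\succ_i$-best element of $\{c\in C: s_i\ge f_c(\mu^{t-1})\}\cup\{\emptyset\}$. *)

theory Defs
  imports Complex_Main "HOL-Library.FuncSet"
begin

text \<open>The outside option is \<open>None\<close>, so the available options are \<open>None\<close> and \<open>Some c\<close> for the
  colleges \<open>c\<close>. A pair \<open>(x, y)\<close> in \<open>pref M i\<close> means that student \<open>i\<close> strictly prefers \<open>x\<close> to \<open>y\<close>.\<close>

record ('i, 'c) admissions =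
  students :: "'i set"
  colleges :: "'c set"
  pref :: "'i \<Rightarrow> 'c option rel"
  capacity :: "'c \<Rightarrow> nat"
  score :: "'i \<Rightarrow> real"

definition actions :: "('i, 'c) admissions \<Rightarrow> 'c option set" where
  "actions M = insert None (Some ` colleges M)"

definition college_admissions :: "('i, 'c) admissions \<Rightarrow> bool" where
  "college_admissions M \<longleftrightarrow>
     finite (students M) \<and> finite (colleges M) \<and>
     (\<forall>i\<in>students M. pref M i \<subseteq> actions M \<times> actions M \<and>
        strict_linear_order_on (actions M) (pref M i)) \<and>
     (\<forall>c\<in>colleges M. capacity M c > 0) \<and>
     (\<forall>i\<in>students M. score M i > 0) \<and>
     inj_on (score M) (students M)"

definition higher_priority :: "('i, 'c) admissions \<Rightarrow> 'i \<Rightarrow> 'i \<Rightarrow> bool" where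
  "higher_priority M i j \<longleftrightarrow> score M i > score M j"

definition assigned :: "('i, 'c) admissions \<Rightarrow> ('i \<Rightarrow> 'c option) \<Rightarrow> 'c \<Rightarrow> 'i set" where
  "assigned M \<mu> c = {i \<in> students M. \<mu> i = Some c}"

definition matching :: "('i, 'c) admissions \<Rightarrow> ('i \<Rightarrow> 'c option) \<Rightarrow> bool" where
  "matching M \<mu> \<longleftrightarrow> \<mu> \<in> students M \<rightarrow> actions M \<and>
     (\<forall>c\<in>colleges M. card (assigned M \<mu> c) \<le> capacity M c)"

definition cutoff :: "('i, 'c) admissions \<Rightarrow> ('i \<Rightarrow> 'c option) \<Rightarrow> 'c \<Rightarrow> real" where
  "cutoff M \<mu> c =
     (if card (assigned M \<mu> c) = capacity M c then Min (score M ` assigned M \<mu> c) else 0)"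

definition profiles :: "('i, 'c) admissions \<Rightarrow> ('i \<Rightarrow> 'c option) set" where
  "profiles M = (students M \<rightarrow>\<^sub>E actions M)"

definition applicants :: "('i, 'c) admissions \<Rightarrow> ('i \<Rightarrow> 'c option) \<Rightarrow> 'c \<Rightarrow> 'i set" where
  "applicants M a c = {i \<in> students M. a i = Some c}"

text \<open>A college holds an applicant iff fewer than its capacity of its applicants have higher
  priority, i.e. it holds its highest-priority applicants up to capacity
  (see \<open>card_held\<close> and \<open>held_top\<close> below).\<close>

definition held :: "('i, 'c) admissions \<Rightarrow> ('i \<Rightarrow> 'c option) \<Rightarrow> 'c \<Rightarrow> 'i set" where
  "held M a c =
     {i \<in> applicants M a c. card {j \<in> applicants M a c. higher_priority M j i} < capacity M c}"

definition tentative :: "('i, 'c) admissions \<Rightarrow> ('i \<Rightarrow> 'c option) \<Rightarrow> 'i \<Rightarrow> 'c option" where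
  "tentative M a i = (if \<exists>c\<in>colleges M. i \<in> held M a c then a i else None)"

text \<open>The history observed in round \<open>t\<close> is the list, in chronological order, of the \<open>t - 1\<close>
  earlier action profiles; hence the lengths of histories are below \<open>T\<close>.\<close>

definition histories :: "('i, 'c) admissions \<Rightarrow> nat \<Rightarrow> ('i \<Rightarrow> 'c option) list set" where
  "histories M T = {h. length h < T \<and> set h \<subseteq> profiles M}"

type_synonym ('i, 'c) strategy = "('i \<Rightarrow> 'c option) list \<Rightarrow> 'c option"

definition strategies :: "('i, 'c) admissions \<Rightarrow> nat \<Rightarrow> ('i, 'c) strategy set" where
  "strategies M T = (histories M T \<rightarrow> actions M)"

primrec play :: "('i, 'c) admissions \<Rightarrow> ('i \<Rightarrow> ('i, 'c) strategy) \<Rightarrow> nat \<Rightarrow> ('i \<Rightarrow> 'c option) list"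
where
  "play M \<sigma> 0 = []"
| "play M \<sigma> (Suc t) = play M \<sigma> t @ [\<lambda>i\<in>students M. \<sigma> i (play M \<sigma> t)]"

text \<open>For \<open>T = 0\<close> the following value is unspecified.\<close>

definition final_matching ::
  "('i, 'c) admissions \<Rightarrow> nat \<Rightarrow> ('i \<Rightarrow> ('i, 'c) strategy) \<Rightarrow> 'i \<Rightarrow> 'c option" where
  "final_matching M T \<sigma> = tentative M (last (play M \<sigma> T))"

definition nash_equilibrium ::
  "('i, 'c) admissions \<Rightarrow> nat \<Rightarrow> ('i \<Rightarrow> ('i, 'c) strategy) \<Rightarrow> bool" where
  "nash_equilibrium M T \<sigma> \<longleftrightarrow>
     (\<forall>i\<in>students M. \<sigma> i \<in> strategies M T) \<and>
     (\<forall>i\<in>students M. \<forall>\<tau>\<in>strategies M T.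
        (final_matching M T (\<sigma>(i := \<tau>)) i, final_matching M T \<sigma> i) \<notin> pref M i)"

definition best :: "'a rel \<Rightarrow> 'a set \<Rightarrow> 'a" where
  "best r X = (THE x. x \<in> X \<and> (\<forall>y\<in>X. y \<noteq> x \<longrightarrow> (x, y) \<in> r))"

definition straightforward :: "('i, 'c) admissions \<Rightarrow> 'i \<Rightarrow> ('i, 'c) strategy" where
  "straightforward M i h =
     (if h = [] then best (pref M i) (actions M)
      else let \<mu> = tentative M (last h) in
        case \<mu> i of
          Some c \<Rightarrow> Some c
        | None \<Rightarrow> best (pref M i)
            (insert None (Some ` {c \<in> colleges M. score M i \<ge> cutoff M \<mu> c})))"

lemma card_top:
  fixes s :: "'i \<Rightarrow> real"
  assumes "finite X" "inj_on s X"
  shows "card {i \<in> X. card {j \<in> X. s j > s i} < n} = min n (card X)"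
  using assms
proof (induction X rule: finite_ranking_induct[where f = "\<lambda>i. - s i"])
  case (insert x S)
  show ?case
  proof (cases "x \<in> S")
    case True
    then show ?thesis using insert by (simp add: insert_absorb)
  next
    case False
    have lt: "s x < s y" if "y \<in> S" for y
      using that insert(2)[OF that] insert.prems False by (force simp: inj_on_def less_le)
    have 1: "{j \<in> insert x S. s j > s i} = {j \<in> S. s j > s i}" if "i \<in> S" for i
      using lt[OF that] by auto
    have 3: "{j \<in> insert x S. s j > s x} = S" using lt by auto
    have "{i \<in> insert x S. card {j \<in> insert x S. s j > s i} < n} =
        {i \<in> S. card {j \<in> S. s j > s i} < n} \<union> (if card S < n then {x} else {})"
      using 1 3 by (auto split: if_splits)
    then show ?thesis using insert False by (simp add: min_def)
  qed
qed simp

lemma card_held: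
  assumes "college_admissions M"
  shows "card (held M a c) = min (capacity M c) (card (applicants M a c))"
proof -
  have "finite (applicants M a c)" "inj_on (score M) (applicants M a c)"
    using assms by (auto simp: college_admissions_def applicants_def inj_on_def)
  from card_top[OF this] show ?thesis
    by (simp add: held_def higher_priority_def)
qed

lemma held_top:
  assumes "college_admissions M" "i \<in> held M a c" "j \<in> applicants M a c" "higher_priority M j i"
  shows "j \<in> held M a c"
proof -
  have "card {k \<in> applicants M a c. higher_priority M k j}
      \<le> card {k \<in> applicants M a c. higher_priority M k i}"
    using assms by (intro card_mono)
      (auto simp: higher_priority_def college_admissions_def applicants_def)
  then show ?thesis using assms by (auto simp: held_def)
qed

lemma matching_tentative:
  assumes "college_admissions M" "a \<in> profiles M"
  shows "matching M (tentative M a)"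
proof -
  have "assigned M (tentative M a) c = held M a c" if "c \<in> colleges M" for c
    using that by (auto simp: assigned_def tentative_def held_def applicants_def split: if_splits)
  moreover have "tentative M a \<in> students M \<rightarrow> actions M"
    using assms(2) by (auto simp: tentative_def profiles_def actions_def dest!: PiE_mem split: if_splits)
  ultimately show ?thesis using card_held[OF assms(1)] by (simp add: matching_def)
qed

end

theory Submission
  imports Defs
begin

text \<open>Whether a seat is open to a student depends only on the applications of students with higher
  priority. Hence a deviator cannot influence students above her. Under straightforward play the set
  of open seats shrinks over time, and by induction on the priority order the student with \<open>k\<close>
  others above her has settled from round \<open>k + 1\<close> on at the best option open to her. So in round \<open>T\<close>
  all students above a deviator are where they would have been anyway, and she chooses from the same
  set of open options, of which straightforward play already gives her the best.\<close>

text \<open>Unlike a cutoff, the count ignores the application of \<open>i\<close> herself. This is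
  thus the menu of outcomes she could secure by one application while the others apply as in
  \<open>a\<close>, whether or not she is currently held.\<close>

definition open_choices :: "('i, 'c) admissions \<Rightarrow> ('i \<Rightarrow> 'c option) \<Rightarrow> 'i \<Rightarrow> 'c option set" where
  "open_choices M a i = insert None (Some ` {c \<in> colleges M.
     card {j \<in> applicants M a c. higher_priority M j i} < capacity M c})"

text \<open>Meant as straightforward behaviour in terms of the last application profile alone.
  \<open>None\<close> is always open, so without the first conjunct an unassigned student would
  never apply again.\<close>

definition respond :: "('i, 'c) admissions \<Rightarrow> ('i \<Rightarrow> 'c option) \<Rightarrow> 'i \<Rightarrow> 'c option" where
  "respond M a i =
     (if a i \<noteq> None \<and> a i \<in> open_choices M a i then a i
      else best (pref M i) (open_choices M a i))"

text \<open>Round \<open>0\<close> is a fictitious round in which nobody applies: all seats are open after it, so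
  that the first round of straightforward play follows the same rule as the later ones.\<close>

definition profile_at ::
  "('i, 'c) admissions \<Rightarrow> ('i \<Rightarrow> ('i, 'c) strategy) \<Rightarrow> nat \<Rightarrow> 'i \<Rightarrow> 'c option" where
  "profile_at M \<sigma> t = last ((\<lambda>_. None) # play M \<sigma> t)"

section \<open>Best elements and elementary facts on open choices\<close>

lemma best_greatest:
  assumes "strict_linear_order_on A r" "X \<subseteq> A" "finite X" "X \<noteq> {}"
  shows "best r X \<in> X" and "\<And>y. y \<in> X \<Longrightarrow> y \<noteq> best r X \<Longrightarrow> (best r X, y) \<in> r"
proof -
  have r: "trans r" "irrefl r" "total_on A r"
    using assms(1) by (auto simp: strict_linear_order_on_def)
  have "\<exists>x. x \<in> X \<and> (\<forall>y\<in>X. y \<noteq> x \<longrightarrow> (x, y) \<in> r)"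
    using assms(3,4,2)
  proof (induction X rule: finite_ne_induct)
    case (insert z X)
    then obtain x where x: "x \<in> X" "\<forall>y\<in>X. y \<noteq> x \<longrightarrow> (x, y) \<in> r" by auto
    have "z \<noteq> x" using x insert by auto
    then consider "(x, z) \<in> r" | "(z, x) \<in> r"
      using r(3) x insert.prems by (auto simp: total_on_def)
    then show ?case
    proof cases
      case 1
      then show ?thesis using x by blast
    next
      case 2
      then have "\<forall>y\<in>X. (z, y) \<in> r" using x(2) r(1) by (metis transD)
      then show ?thesis by blast
    qed
  qed simp
  moreover have "x = y"
    if "x \<in> X \<and> (\<forall>y\<in>X. y \<noteq> x \<longrightarrow> (x, y) \<in> r)" "y \<in> X \<and> (\<forall>z\<in>X. z \<noteq> y \<longrightarrow> (y, z) \<in> r)" for x y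
    using that r by (metis irrefl_def transD)
  ultimately have "\<exists>!x. x \<in> X \<and> (\<forall>y\<in>X. y \<noteq> x \<longrightarrow> (x, y) \<in> r)" by blast
  from theI'[OF this] show "best r X \<in> X" "\<And>y. y \<in> X \<Longrightarrow> y \<noteq> best r X \<Longrightarrow> (best r X, y) \<in> r"
    unfolding best_def by blast+
qed

lemma finite_applicants: "finite (students M) \<Longrightarrow> finite (applicants M a c)"
  by (simp add: applicants_def)

lemma None_in_open_choices: "None \<in> open_choices M a i"
  by (simp add: open_choices_def)

lemma open_choices_subset_actions: "open_choices M a i \<subseteq> actions M"
  by (auto simp: open_choices_def actions_def)

lemma open_choices_cong:
  assumes "\<And>j. j \<in> students M \<Longrightarrow> higher_priority M j i \<Longrightarrow> a j = b j"
  shows "open_choices M a i = open_choices M b i"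
proof -
  have "{j \<in> applicants M a c. higher_priority M j i} = {j \<in> applicants M b c. higher_priority M j i}"
    for c using assms by (auto simp: applicants_def)
  then show ?thesis by (simp add: open_choices_def)
qed

text \<open>For a student who applies to a college, being held and finding the college open are the
  same count. Outcomes can therefore be read off from menus.\<close>

lemma tentative_eq_open:
  assumes "i \<in> students M"
  shows "tentative M a i = (if a i \<in> open_choices M a i then a i else None)"
  using assms by (cases "a i") (auto simp: tentative_def held_def applicants_def open_choices_def)

section \<open>One round of play: cutoffs, responses and shrinking menus\<close>

context
  fixes M :: "('i, 'c) admissions"
  assumes adm: "college_admissions M"
begin

lemma finite_students: "finite (students M)"
  using adm by (simp add: college_admissions_def)

lemma finite_actions: "finite (actions M)"
  using adm by (simp add: college_admissions_def actions_def)

lemma pref_order: "i \<in> students M \<Longrightarrow> strict_linear_order_on (actions M) (pref M i)"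
  using adm by (simp add: college_admissions_def)

lemma best_open:
  assumes "i \<in> students M"
  shows "best (pref M i) (open_choices M a i) \<in> open_choices M a i"
    and "\<And>y. y \<in> open_choices M a i \<Longrightarrow> y \<noteq> best (pref M i) (open_choices M a i) \<Longrightarrow>
      (best (pref M i) (open_choices M a i), y) \<in> pref M i"
proof -
  have "open_choices M a i \<noteq> {}" using None_in_open_choices[of M a i] by auto
  note greatest = best_greatest[OF pref_order[OF assms] open_choices_subset_actions
    finite_subset[OF open_choices_subset_actions finite_actions] this]
  show "best (pref M i) (open_choices M a i) \<in> open_choices M a i"
    by (rule greatest(1))
  show "\<And>y. y \<in> open_choices M a i \<Longrightarrow> y \<noteq> best (pref M i) (open_choices M a i) \<Longrightarrow>
      (best (pref M i) (open_choices M a i), y) \<in> pref M i"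
    by (rule greatest(2))
qed

lemma assigned_tentative: "c \<in> colleges M \<Longrightarrow> assigned M (tentative M a) c = held M a c"
  by (auto simp: assigned_def tentative_def held_def applicants_def split: if_splits)

text \<open>Both sides are negated: the cutoff exceeds the score of \<open>i\<close> iff the college
  is full and holds only students above her, which happens iff the applicants above her alone fill
  it.\<close>

lemma cutoff_le_iff_open:
  assumes i: "i \<in> students M" and c: "c \<in> colleges M" and un: "tentative M a i = None"
  shows "cutoff M (tentative M a) c \<le> score M i \<longleftrightarrow> Some c \<in> open_choices M a i"
proof -
  let ?A = "applicants M a c" and ?H = "held M a c" and ?q = "capacity M c"
  let ?U = "{j \<in> ?A. higher_priority M j i}"
  have q: "?q > 0" and inj: "inj_on (score M) (students M)" and pos: "score M i > 0"
    using adm i c by (auto simp: college_admissions_def)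
  have finA: "finite ?A" by (rule finite_applicants[OF finite_students])
  have finH: "finite ?H" using finA by (simp add: held_def)
  have iH: "i \<notin> ?H"
    using un c assigned_tentative[OF c, of a] by (force simp: assigned_def)
  have ne: "score M j \<noteq> score M i" if "j \<in> ?H" for j
    using that iH inj i by (auto simp: held_def applicants_def inj_on_def)
  have "card ?H = ?q \<and> (\<forall>j\<in>?H. score M i < score M j) \<longleftrightarrow> ?q \<le> card ?U"
  proof
    assume *: "card ?H = ?q \<and> (\<forall>j\<in>?H. score M i < score M j)"
    then have "?H \<subseteq> ?U" by (auto simp: held_def higher_priority_def)
    then show "?q \<le> card ?U" using * card_mono[of ?U ?H] finA by simp
  next
    assume *: "?q \<le> card ?U"
    also have "card ?U \<le> card ?A" using finA by (intro card_mono) auto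
    finally have "card ?H = ?q" using card_held[OF adm, of a c] by simp
    moreover have "score M i < score M j" if j: "j \<in> ?H" for j
    proof (rule ccontr)
      assume "\<not> ?thesis"
      \<comment> \<open>If \<open>j\<close> is not above \<open>i\<close>, everyone above
        \<open>i\<close> is above \<open>j\<close>, so too many applicants beat \<open>j\<close> for
        her to be held.\<close>
      then have "?U \<subseteq> {k \<in> ?A. higher_priority M k j}"
        by (auto simp: higher_priority_def)
      then have "card ?U \<le> card {k \<in> ?A. higher_priority M k j}" using finA by (intro card_mono) auto
      then show False using j * by (simp add: held_def)
    qed
    ultimately show "card ?H = ?q \<and> (\<forall>j\<in>?H. score M i < score M j)" by blast
  qed
  moreover have "score M i < cutoff M (tentative M a) c \<longleftrightarrow>
      card ?H = ?q \<and> (\<forall>j\<in>?H. score M i < score M j)"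
  proof (cases "card ?H = ?q")
    case True
    then have "?H \<noteq> {}" using q by auto
    then show ?thesis using True finH by (simp add: cutoff_def assigned_tentative[OF c])
  next
    case False
    \<comment> \<open>A college with free seats has cutoff 0, and scores are positive.\<close>
    then show ?thesis using pos by (simp add: cutoff_def assigned_tentative[OF c])
  qed
  ultimately show ?thesis using c by (auto simp: open_choices_def not_less[symmetric])
qed

text \<open>Eliminates cutoffs and tentative matchings: straightforward play becomes iteration of
  \<open>respond\<close>. Positive capacities open every college after the empty profile, which
  settles the first round.\<close>

lemma straightforward_respond:
  assumes i: "i \<in> students M"
  shows "straightforward M i h = respond M (last ((\<lambda>_. None) # h)) i"
proof (cases "h = []")
  case True
  have "open_choices M (\<lambda>_. None) i = actions M"
    using adm by (auto simp: open_choices_def actions_def applicants_def college_admissions_def)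
  then show ?thesis using True by (simp add: straightforward_def respond_def)
next
  case False
  let ?a = "last h"
  have "insert None (Some ` {c \<in> colleges M. cutoff M (tentative M ?a) c \<le> score M i}) =
      open_choices M ?a i" if "tentative M ?a i = None"
    using cutoff_le_iff_open[OF i _ that]
    by (auto simp: open_choices_def image_iff)
  then show ?thesis using False tentative_eq_open[OF i, of ?a]
    by (auto simp: straightforward_def respond_def Let_def split: option.splits)
qed

lemma respond_in_open: "i \<in> students M \<Longrightarrow> respond M a i \<in> open_choices M a i"
  by (simp add: respond_def best_open)

text \<open>If a college is closed to \<open>i\<close>, the best applicants above her fill it. They
  are held, hence apply there again, and keep it closed to her.\<close>

lemma open_choices_antimono:
  assumes resp: "\<And>j. j \<in> students M \<Longrightarrow> b j = respond M a j"
  shows "open_choices M b i \<subseteq> open_choices M a i"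
proof
  fix x assume x: "x \<in> open_choices M b i"
  show "x \<in> open_choices M a i"
  proof (rule ccontr)
    assume nx: "x \<notin> open_choices M a i"
    then obtain c where c: "x = Some c" "c \<in> colleges M"
      using x by (auto simp: open_choices_def)
    let ?q = "capacity M c"
    let ?X = "{j \<in> applicants M a c. higher_priority M j i}"
    let ?Y = "{j \<in> ?X. card {k \<in> ?X. score M k > score M j} < ?q}"
    have "?q \<le> card ?X" using nx c by (auto simp: open_choices_def not_less)
    moreover have "finite ?X" "inj_on (score M) ?X"
      using adm finite_applicants[OF finite_students]
      by (auto simp: college_admissions_def applicants_def inj_on_def)
    ultimately have "card ?Y = ?q" using card_top[of ?X "score M" ?q] by simp
    moreover have "?Y \<subseteq> {j \<in> applicants M b c. higher_priority M j i}"
    proof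
      fix j assume j: "j \<in> ?Y"
      \<comment> \<open>\<open>?X\<close> is upward closed among the applicants to \<open>c\<close>,
        so ranking \<open>j\<close> within \<open>?X\<close> or among all of them gives the same
        count.\<close>
      then have "{k \<in> ?X. score M k > score M j} = {k \<in> applicants M a c. higher_priority M k j}"
        by (auto simp: higher_priority_def)
      then have "j \<in> held M a c" using j by (simp add: held_def)
      then have "j \<in> students M" "a j = Some c" "Some c \<in> open_choices M a j"
        using c by (auto simp: held_def applicants_def open_choices_def)
      then have "b j = Some c" using resp by (simp add: respond_def)
      then show "j \<in> {j \<in> applicants M b c. higher_priority M j i}"
        using j by (simp add: applicants_def)
    qed
    then have "card ?Y \<le> card {j \<in> applicants M b c. higher_priority M j i}"
      using finite_applicants[OF finite_students] by (intro card_mono) auto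
    ultimately show False using x c by (auto simp: open_choices_def)
  qed
qed

section \<open>Iterated responses from the empty profile\<close>

context
  fixes b :: "nat \<Rightarrow> 'i \<Rightarrow> 'c option"
  assumes start: "b 0 = (\<lambda>_. None)"
    and step: "\<And>t j. j \<in> students M \<Longrightarrow> b (Suc t) j = respond M (b t) j"
begin

text \<open>The current application was once chosen as the best of a menu, and menus only shrink
  afterwards. It may itself have been closed in the meantime. At round 0 nothing has been chosen
  yet, hence \<open>t > 0\<close>.\<close>

lemma application_beats_open:
  assumes i: "i \<in> students M" and "t > 0"
    and "y \<in> open_choices M (b t) i" "y \<noteq> b t i"
  shows "(b t i, y) \<in> pref M i"
  using assms(2-)
proof (induction t)
  case (Suc t)
  have y: "y \<in> open_choices M (b t) i"
    using open_choices_antimono[of "b (Suc t)" "b t"] step Suc.prems by blast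
  show ?case
  proof (cases "b t i \<noteq> None \<and> b t i \<in> open_choices M (b t) i")
    case True
    then have "b (Suc t) i = b t i" using step[OF i] by (simp add: respond_def)
    moreover have "t > 0" using True start by (cases t) auto
    ultimately show ?thesis using Suc y by simp
  next
    case False
    then have "b (Suc t) i = best (pref M i) (open_choices M (b t) i)"
      unfolding step[OF i] respond_def by argo
    then show ?thesis using best_open(2)[OF i y] Suc.prems by simp
  qed
qed simp

text \<open>Everyone above \<open>i\<close> has settled one round earlier, so the menu from which
  \<open>i\<close> chose her application in round \<open>t\<close> is still her menu after that
  round. Her choice is therefore open, and she repeats it.\<close>

lemma settled:
  assumes "i \<in> students M" "card {j \<in> students M. higher_priority M j i} < t"
  shows "b t i \<in> open_choices M (b t) i \<and> b (Suc t) i = b t i"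
  using assms
proof (induction "card {j \<in> students M. higher_priority M j i}" arbitrary: i t rule: less_induct)
  case less
  then obtain t' where t: "t = Suc t'" by (cases t) auto
  have "b t j = b t' j" if j: "j \<in> students M" "higher_priority M j i" for j
  proof -
    have "{k \<in> students M. higher_priority M k j} \<subset> {k \<in> students M. higher_priority M k i}"
      using j by (auto simp: higher_priority_def)
    then have lt: "card {k \<in> students M. higher_priority M k j} <
        card {k \<in> students M. higher_priority M k i}"
      using finite_students by (intro psubset_card_mono) auto
    then have "card {k \<in> students M. higher_priority M k j} < t'"
      using less.prems(2) t by linarith
    from less.hyps[OF lt j(1) this] show ?thesis unfolding t by blast
  qed
  then have "open_choices M (b t) i = open_choices M (b t') i" by (rule open_choices_cong)
  then have mem: "b t i \<in> open_choices M (b t) i"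
    using respond_in_open[OF less.prems(1), of "b t'"] step[OF less.prems(1)] t by simp
  have "b (Suc t) i = b t i"
  proof (cases "b t i")
    case (Some c)
    then show ?thesis using mem step[OF less.prems(1)] by (simp add: respond_def)
  next
    case None
    \<comment> \<open>\<open>None\<close> is not repeated automatically but recomputed. As it
      already beats every other open option, a different \<open>?z\<close> would make each preferred
      to the other.\<close>
    let ?z = "best (pref M i) (open_choices M (b t) i)"
    have z: "b (Suc t) i = ?z" using None step[OF less.prems(1)] by (simp add: respond_def)
    show ?thesis
    proof (rule ccontr)
      assume ne: "b (Suc t) i \<noteq> b t i"
      have "(b t i, ?z) \<in> pref M i"
        using application_beats_open[OF less.prems(1)] best_open(1)[OF less.prems(1)] ne z t by simp
      moreover have "(?z, b t i) \<in> pref M i"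
        using best_open(2)[OF less.prems(1) mem] ne z by simp
      ultimately show False
        using pref_order[OF less.prems(1)] by (metis strict_linear_order_on_def irrefl_def transD)
    qed
  qed
  then show ?case using mem by blast
qed

end

section \<open>The game and a single deviator\<close>

lemma straightforward_in_strategies:
  assumes "i \<in> students M"
  shows "straightforward M i \<in> strategies M T"
proof -
  have "straightforward M i h \<in> actions M" for h
    unfolding straightforward_respond[OF assms]
    by (rule subsetD[OF open_choices_subset_actions respond_in_open[OF assms]])
  then show ?thesis by (simp add: strategies_def)
qed

text \<open>Only \<open>i\<close> need be straightforward, so the recursion also applies to the
  others when one student deviates.\<close>

lemma profile_at_Suc:
  assumes "i \<in> students M" "\<sigma> i = straightforward M i"
  shows "profile_at M \<sigma> (Suc t) i = respond M (profile_at M \<sigma> t) i"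
  using assms straightforward_respond[OF assms(1)] by (simp add: profile_at_def)

text \<open>Whoever is above \<open>j\<close> is also above \<open>d\<close>, so the induction
  hypothesis fixes the menu of \<open>j\<close>. Applied to \<open>j\<close> herself, it fixes her
  last application, and \<open>respond\<close> depends on nothing else.\<close>

lemma deviation_unnoticed_above:
  assumes "j \<in> students M" "higher_priority M j d"
  shows "profile_at M ((straightforward M)(d := \<tau>)) t j = profile_at M (straightforward M) t j"
  using assms
proof (induction t arbitrary: j)
  case 0
  then show ?case by (simp add: profile_at_def)
next
  case (Suc t)
  let ?\<sigma> = "(straightforward M)(d := \<tau>)"
  have "?\<sigma> j = straightforward M j" using Suc.prems by (auto simp: higher_priority_def)
  then have "profile_at M ?\<sigma> (Suc t) j = respond M (profile_at M ?\<sigma> t) j"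
    by (rule profile_at_Suc[OF Suc.prems(1)])
  moreover have "open_choices M (profile_at M ?\<sigma> t) j =
      open_choices M (profile_at M (straightforward M) t) j"
    using Suc.prems by (intro open_choices_cong Suc.IH) (auto simp: higher_priority_def)
  ultimately show ?case
    unfolding respond_def profile_at_Suc[where \<sigma> = "straightforward M", OF Suc.prems(1) refl] Suc.IH[OF Suc.prems]
    by (simp only:)
qed

end

theorem proposition2:
  fixes M :: "('i, 'c) admissions" and T :: nat
  assumes "college_admissions M"
    and "T \<ge> card (students M)"
  shows "nash_equilibrium M T (straightforward M)"
  unfolding nash_equilibrium_def
proof (intro conjI ballI)
  fix i assume "i \<in> students M"
  then show "straightforward M i \<in> strategies M T"
    by (rule straightforward_in_strategies[OF assms(1)])
next
  fix i \<tau> assume i: "i \<in> students M"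
  let ?b = "profile_at M (straightforward M)"
  let ?a = "profile_at M ((straightforward M)(i := \<tau>))"
  \<comment> \<open>A student is not above herself, so at most |I| - 1 students are above her, and
    |I| rounds suffice for her to settle.\<close>
  have "{j \<in> students M. higher_priority M j i} \<subset> students M"
    using i by (auto simp: higher_priority_def)
  from psubset_card_mono[OF finite_students[OF assms(1)] this]
  have T: "card {j \<in> students M. higher_priority M j i} < T"
    using assms(2) by linarith
  \<comment> \<open>Since \<open>T\<close> is positive, the fictitious round does not affect the
    last profile.\<close>
  have final: "final_matching M T \<sigma> = tentative M (profile_at M \<sigma> T)" for \<sigma>
    using T by (cases T) (simp_all add: final_matching_def profile_at_def)
  have start: "?b 0 = (\<lambda>_. None)" by (simp add: profile_at_def)
  have step: "?b (Suc t) j = respond M (?b t) j" if "j \<in> students M" for t j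
    using profile_at_Suc[OF assms(1) that] by simp
  have "?b T i \<in> open_choices M (?b T) i"
    using settled[OF assms(1) start step i T] by simp
  then have b: "tentative M (?b T) i = ?b T i" by (simp add: tentative_eq_open[OF i])
  have "open_choices M (?a T) i = open_choices M (?b T) i"
    by (intro open_choices_cong deviation_unnoticed_above[OF assms(1)])
  \<comment> \<open>Rejection yields \<open>None\<close>, which is always open. Whatever \<tau>
    does, the deviator's outcome lies in her menu under undisturbed play, where
    \<open>?b T i\<close> is best.\<close>
  then have a: "tentative M (?a T) i \<in> open_choices M (?b T) i"
    by (simp add: tentative_eq_open[OF i] None_in_open_choices)
  have "tentative M (?a T) i = ?b T i \<or> (?b T i, tentative M (?a T) i) \<in> pref M i"
    using application_beats_open[OF assms(1) start step i _ a] T by auto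
  then show "(final_matching M T ((straightforward M)(i := \<tau>)) i,
      final_matching M T (straightforward M) i) \<notin> pref M i"
    unfolding final b using pref_order[OF assms(1) i]
    by (metis strict_linear_order_on_def irrefl_def transD)
qed

end
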